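(* Let $\langle X,\mu\rangle$ be a measure space with $\mu(X)<\infty$. Let $f:X\to\mathbb{R}$ be a measurable function with $|f|<M\in\mathbb{R}$. Let $I=(-M,M)\setminus\{0\}$ with the usual metric and let $s:[I]^{<\infty}\to\mathbb{R}$ be defined as follows: for $H\in[I]^{<\infty}$ write $H\cup\{0\}=\{a_1,\dots,a_n\}$ with $a_1<\dots<a_n$, put $a_0=-M$, $a_{n+1}=M$ and \[s(H)=\sum_{i=0}^{n}a_i\,\mu\big(f^{-1}([a_i,a_{i+1}))\big).\] Then $\mathrm{ext}(s,I)$ exists and equals $\int_X f\,d\mu$.
   Context: For a set $I$, $[I]^{<\infty}$ is the set of all finite subsets of $I$. For a pseudo-metric space $(I,d)$, $A\subset I$ and $\epsilon>0$, let $S(A,\epsilon)=\bigcup_{x\in A}\{y\in I: d(x,y)<\epsilon\}$. The Hausdorff pseudo-metric on subsets of $I$ is $d_H(A,C)=\inf\{\epsilon>0: A\subset S(C,\epsilon),\ C\subset S(A,\epsilon)\}$ (with $\inf\emptyset=+\infty$). $I$ is totally bounded if for every $\delta>0$ there is a finite $K\subset I$ with $S(K,\delta)=I$. Let $(I,d)$ be a totally bounded pseudo-metric space, $s:[I]^{<\infty}\to\mathbb{R}$ and $A\in\mathbb{R}$. We write $\mathrm{ext}(s,I)=A$ (and say that $\mathrm{ext}(s,I)$ exists) if for every $\epsilon>0$ there is $\delta>0$ such that $K\in[I]^{<\infty}$ and $d_H(K,I)<\delta$ imply $|s(K)-A|<\epsilon$. *)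

theory Defs
  imports "HOL-Analysis.Analysis"
begin

text \<open>The library has metric spaces only, so pseudo-metrics are given here by a carrier
  \<open>I\<close> and a distance function \<open>d\<close> that is only constrained on \<open>I\<close>.\<close>

definition pseudometric_on :: "'i set \<Rightarrow> ('i \<Rightarrow> 'i \<Rightarrow> real) \<Rightarrow> bool" where
  "pseudometric_on I d \<longleftrightarrow>
     (\<forall>x\<in>I. \<forall>y\<in>I. 0 \<le> d x y) \<and>
     (\<forall>x\<in>I. d x x = 0) \<and>
     (\<forall>x\<in>I. \<forall>y\<in>I. d x y = d y x) \<and>
     (\<forall>x\<in>I. \<forall>y\<in>I. \<forall>z\<in>I. d x z \<le> d x y + d y z)"

definition nbhd_on :: "'i set \<Rightarrow> ('i \<Rightarrow> 'i \<Rightarrow> real) \<Rightarrow> 'i set \<Rightarrow> real \<Rightarrow> 'i set" where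
  "nbhd_on I d A \<epsilon> = (\<Union>x\<in>A. {y\<in>I. d x y < \<epsilon>})"

text \<open>The distance is extended-real valued, because \<open>Inf {} = \<infinity>\<close> is needed.\<close>

definition hausdorff_dist_on ::
  "'i set \<Rightarrow> ('i \<Rightarrow> 'i \<Rightarrow> real) \<Rightarrow> 'i set \<Rightarrow> 'i set \<Rightarrow> ereal" where
  "hausdorff_dist_on I d A C =
     Inf {ereal \<epsilon> |\<epsilon>. 0 < \<epsilon> \<and> A \<subseteq> nbhd_on I d C \<epsilon> \<and> C \<subseteq> nbhd_on I d A \<epsilon>}"

definition totally_bounded_on :: "'i set \<Rightarrow> ('i \<Rightarrow> 'i \<Rightarrow> real) \<Rightarrow> bool" where
  "totally_bounded_on I d \<longleftrightarrow>
     (\<forall>\<delta>>0. \<exists>K. finite K \<and> K \<subseteq> I \<and> nbhd_on I d K \<delta> = I)"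

text \<open>\<open>has_ext I d s A\<close> renders ``\<open>ext(s, I)\<close> exists and equals \<open>A\<close>''.  The notion is only
  introduced for totally bounded pseudo-metric spaces, so that requirement is part of it.
  Only the values of \<open>s\<close> at finite subsets of \<open>I\<close> matter.\<close>

definition has_ext ::
  "'i set \<Rightarrow> ('i \<Rightarrow> 'i \<Rightarrow> real) \<Rightarrow> ('i set \<Rightarrow> real) \<Rightarrow> real \<Rightarrow> bool" where
  "has_ext I d s A \<longleftrightarrow>
     pseudometric_on I d \<and> totally_bounded_on I d \<and>
     (\<forall>\<epsilon>>0. \<exists>\<delta>>0. \<forall>K. finite K \<and> K \<subseteq> I \<and> hausdorff_dist_on I d K I < ereal \<delta>
        \<longrightarrow> \<bar>s K - A\<bar> < \<epsilon>)"

text \<open>The points \<open>a\<^sub>0, \<dots>, a\<^sub>n\<^sub>+\<^sub>1\<close>: the elements of \<open>H \<union> {0}\<close> in increasing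
  order, preceded by \<open>-M\<close> and followed by \<open>M\<close>.\<close>

definition partition_points :: "real \<Rightarrow> real set \<Rightarrow> real list" where
  "partition_points M H = (- M) # sorted_list_of_set (H \<union> {0}) @ [M]"

definition lebesgue_sum :: "'a measure \<Rightarrow> ('a \<Rightarrow> real) \<Rightarrow> real \<Rightarrow> real set \<Rightarrow> real" where
  "lebesgue_sum \<mu> f M H =
     (let a = (!) (partition_points M H); n = card (H \<union> {0})
      in \<Sum>i=0..n. a i * measure \<mu> (f -` {a i..<a (Suc i)} \<inter> space \<mu>))"

end

theory Submission
  imports Defs
begin

text \<open>
  The sum is the integral of the simple function that rounds \<open>f\<close> down to the nearest partition
  point, so it differs from the integral of \<open>f\<close> by at most the mesh of the partition times
  \<open>\<mu>(X)\<close>. The midpoint of two consecutive partition points lies in \<open>I\<close>, because \<open>0\<close> is itself a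
  partition point, and no point of \<open>K\<close> lies strictly between the two; so if \<open>K\<close> has Hausdorff
  distance less than \<open>\<delta>\<close> from \<open>I\<close>, then the mesh is less than \<open>2\<delta>\<close>.
\<close>

lemma pseudometric_on_dist: "pseudometric_on I dist"
  by (simp add: pseudometric_on_def dist_commute dist_triangle)

text \<open>By Heine-Borel the closure of \<open>I\<close> is compact, and every point of it is
  within \<open>\<delta>\<close> of some point of \<open>I\<close>. The balls centred in
  \<open>I\<close> thus have a finite subcover, whose centres lie in \<open>I\<close> itself as
  total boundedness demands.\<close>

lemma bounded_imp_totally_bounded_on_dist:
  fixes I :: "'a::heine_borel set"
  assumes "bounded I"
  shows "totally_bounded_on I dist"
  unfolding totally_bounded_on_def
proof (intro allI impI)
  fix \<delta> :: real
  assume "\<delta> > 0"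
  then have "closure I \<subseteq> (\<Union>x\<in>I. ball x \<delta>)"
    by (force simp: closure_approachable)
  then obtain K where "K \<subseteq> I" "finite K" "closure I \<subseteq> (\<Union>x\<in>K. ball x \<delta>)"
    using compactE_image[of "closure I" I "\<lambda>x. ball x \<delta>"] assms by (metis compact_closure open_ball)
  moreover from this have "nbhd_on I dist K \<delta> = I"
    using closure_subset[of I] by (fastforce simp: nbhd_on_def)
  ultimately show "\<exists>K. finite K \<and> K \<subseteq> I \<and> nbhd_on I dist K \<delta> = I"
    by blast
qed

lemma hausdorff_dist_on_lessD:
  assumes "hausdorff_dist_on I d A C < ereal \<delta>" and "y \<in> C"
  obtains x where "x \<in> A" and "d x y < \<delta>"
  using assms unfolding hausdorff_dist_on_def nbhd_on_def Inf_less_iff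
  by fastforce

lemma sum_indicator_consecutive:
  fixes a :: "nat \<Rightarrow> real"
  assumes "\<And>i. i < n \<Longrightarrow> a i \<le> a (Suc i)"
  shows "(\<Sum>i<n. indicator {a i..<a (Suc i)} y :: real) = indicator {a 0..<a n} y"
proof -
  \<comment> \<open>The induction must carry \<open>a 0 \<le> a n\<close>: only then do
    \<open>{a 0..<a n}\<close> and \<open>{a n..<a (Suc n)}\<close> join up to
    \<open>{a 0..<a (Suc n)}\<close>.\<close>
  have "a 0 \<le> a n \<and> (\<Sum>i<n. indicator {a i..<a (Suc i)} y :: real) = indicator {a 0..<a n} y"
    using assms
  proof (induction n)
    case (Suc n)
    then have "a 0 \<le> a n" "a n \<le> a (Suc n)"
      and "(\<Sum>i<n. indicator {a i..<a (Suc i)} y :: real) = indicator {a 0..<a n} y"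
      by auto
    then show ?case
      unfolding sum.lessThan_Suc by (auto split: split_indicator)
  qed simp
  then show ?thesis
    by blast
qed

lemma (in finite_measure) lebesgue_sum_error:
  fixes f :: "'a \<Rightarrow> real" and a :: "nat \<Rightarrow> real"
  assumes f[measurable]: "f \<in> borel_measurable M"
    and range: "\<And>x. x \<in> space M \<Longrightarrow> f x \<in> {a 0..<a n}"
    and mono: "\<And>i. i < n \<Longrightarrow> a i \<le> a (Suc i)"
    and mesh: "\<And>i. i < n \<Longrightarrow> a (Suc i) - a i \<le> \<eta>"
  shows "\<bar>(\<Sum>i<n. a i * measure M (f -` {a i..<a (Suc i)} \<inter> space M)) - integral\<^sup>L M f\<bar>
    \<le> \<eta> * measure M (space M)"
proof -
  let ?B = "\<lambda>i. f -` {a i..<a (Suc i)} \<inter> space M"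
  define g where "g x = (\<Sum>i<n. a i * indicator (?B i) x)" for x
  have [measurable]: "?B i \<in> sets M" for i
    by measurable
  have int_g: "integrable M g"
    unfolding g_def
    by (intro Bochner_Integration.integrable_sum integrable_mult_right) (simp add: emeasure_finite less_top[symmetric])
  have integral_g: "integral\<^sup>L M g = (\<Sum>i<n. a i * measure M (?B i))"
    unfolding g_def
    by (subst Bochner_Integration.integral_sum)
       (auto simp: emeasure_finite less_top[symmetric] Int_absorb2)
  have "\<bar>f x\<bar> \<le> \<bar>a 0\<bar> + \<bar>a n\<bar>" if "x \<in> space M" for x
    using range[OF that] by auto
  then have int_f: "integrable M f"
    by (intro integrable_const_bound[where B = "\<bar>a 0\<bar> + \<bar>a n\<bar>"]) auto
  have close: "\<bar>g x - f x\<bar> \<le> \<eta>" if x: "x \<in> space M" for x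
  proof -
    have "indicator (?B i) x = (indicator {a i..<a (Suc i)} (f x) :: real)" for i
      using x by (simp add: indicator_def)
    then have one: "(\<Sum>i<n. indicator (?B i) x :: real) = 1"
      using sum_indicator_consecutive[of n a "f x", OF mono] range[OF x] by simp
    \<comment> \<open>Since the indicators sum to 1, \<open>f x\<close> can be moved inside the sum.
      A term survives only if \<open>f x\<close> lies in its cell, and there \<open>a i\<close> is
      at most the cell length, hence at most \<open>\<eta>\<close>, away from
      \<open>f x\<close>.\<close>
    have "g x - f x = (\<Sum>i<n. (a i - f x) * indicator (?B i) x)"
      using one by (simp add: g_def left_diff_distrib sum_subtractf flip: sum_distrib_left)
    also have "\<bar>\<dots>\<bar> \<le> (\<Sum>i<n. \<eta> * indicator (?B i) x)"
    proof (intro order.trans[OF sum_abs] sum_mono)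
      fix i
      assume "i \<in> {..<n}"
      then show "\<bar>(a i - f x) * indicator (?B i) x\<bar> \<le> \<eta> * indicator (?B i) x"
        using mesh[of i] by (cases "x \<in> ?B i") auto
    qed
    also have "\<dots> = \<eta>"
      using one by (simp flip: sum_distrib_left)
    finally show ?thesis .
  qed
  have "\<bar>integral\<^sup>L M g - integral\<^sup>L M f\<bar> = \<bar>\<integral>x. g x - f x \<partial>M\<bar>"
    using int_f int_g by simp
  also have "\<dots> \<le> (\<integral>x. \<bar>g x - f x\<bar> \<partial>M)"
    by (rule integral_abs_bound)
  also have "\<dots> \<le> (\<integral>x. \<eta> \<partial>M)"
    using int_f int_g close by (intro integral_mono) auto
  finally show ?thesis
    by (simp add: integral_g mult.commute)
qed

lemma partition_points_first: "partition_points M H ! 0 = - M"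
  by (simp add: partition_points_def)

lemma partition_points_last:
  "finite H \<Longrightarrow> partition_points M H ! Suc (card (H \<union> {0})) = M"
  by (simp add: partition_points_def nth_append
      del: Un_insert_right sorted_list_of_set_insert_remove)

text \<open>Positivity of \<open>M\<close> places the inserted point 0, like those of
  \<open>H\<close>, strictly between the two end points.\<close>

lemma strict_sorted_partition_points:
  assumes "finite H" "H \<subseteq> {-M<..<M}" "M > 0"
  shows "sorted_wrt (<) (partition_points M H)"
  using assms strict_sorted_list_of_set[of "H \<union> {0}"]
  by (auto simp: partition_points_def sorted_wrt_append
      simp del: Un_insert_right sorted_list_of_set_insert_remove)

lemma partition_points_mesh:
  assumes K: "finite K" "K \<subseteq> {-M<..<M} - {0}" and "M > 0"
    and dist: "hausdorff_dist_on ({-M<..<M} - {0}) dist K ({-M<..<M} - {0}) < ereal \<delta>"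
    and i: "i \<le> card (K \<union> {0})"
  shows "partition_points M K ! i < partition_points M K ! Suc i"
    and "partition_points M K ! Suc i - partition_points M K ! i < 2 * \<delta>"
proof -
  let ?p = "partition_points M K"
  have len: "length ?p = Suc (Suc (card (K \<union> {0})))"
    by (simp add: partition_points_def)
  have sorted: "?p ! j < ?p ! k" if "j < k" "k < length ?p" for j k
    using strict_sorted_partition_points[of K M] K \<open>M > 0\<close> that by (auto simp: sorted_wrt_iff_nth_less)
  show less: "?p ! i < ?p ! Suc i"
    using sorted i len by simp
  have "K \<union> {0} \<subseteq> set ?p"
    using K by (auto simp: partition_points_def
        simp del: Un_insert_right sorted_list_of_set_insert_remove)
  \<comment> \<open>A point of the list has an index at most \<open>i\<close> or at least
    \<open>Suc i\<close>, so by sortedness it cannot fall strictly in between.\<close>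
  have gap: "\<not> (?p ! i < y \<and> y < ?p ! Suc i)" if y: "y \<in> K \<union> {0}" for y
  proof -
    obtain j where j: "j < length ?p" "y = ?p ! j"
      using \<open>K \<union> {0} \<subseteq> set ?p\<close> y by (metis in_set_conv_nth subsetD)
    show ?thesis
    proof (cases "j \<le> i")
      case True
      then show ?thesis
        using sorted[of j i] j i len by (cases "j = i") auto
    next
      case False
      then show ?thesis
        using sorted[of "Suc i" j] j by (cases "j = Suc i") auto
    qed
  qed
  define m where "m = (?p ! i + ?p ! Suc i) / 2"
  have m: "?p ! i < m" "m < ?p ! Suc i"
    using less by (auto simp: m_def)
  have "?p ! 0 \<le> ?p ! i"
    using sorted[of 0 i] i len by (cases "i = 0") auto
  moreover have "?p ! Suc i \<le> ?p ! Suc (card (K \<union> {0}))"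
    using sorted[of "Suc i" "Suc (card (K \<union> {0}))"] i len
    by (cases "i = card (K \<union> {0})") auto
  ultimately have "- M \<le> ?p ! i" "?p ! Suc i \<le> M"
    using K by (simp_all only: partition_points_first partition_points_last)
  \<comment> \<open>The case \<open>y = 0\<close> of \<open>gap\<close> is what gives
    \<open>m \<noteq> 0\<close>.\<close>
  then have "m \<in> {-M<..<M} - {0}"
    using m gap[of 0] by auto
  then obtain k where k: "k \<in> K" "dist k m < \<delta>"
    using hausdorff_dist_on_lessD[OF dist] by blast
  \<comment> \<open>By \<open>gap\<close>, \<open>k\<close> is outside the open cell, so its
    distance from the midpoint \<open>m\<close> is at least half the cell length.\<close>
  then show "?p ! Suc i - ?p ! i < 2 * \<delta>"
    using gap[of k] unfolding m_def dist_real_def by (auto simp only: Un_iff) argo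
qed

lemma lebesgue_sum_close:
  assumes "finite_measure \<mu>"
    and "f \<in> borel_measurable \<mu>"
    and bound: "\<And>x. x \<in> space \<mu> \<Longrightarrow> \<bar>f x\<bar> < M"
    and K: "finite K" "K \<subseteq> {-M<..<M} - {0}"
    and dist: "hausdorff_dist_on ({-M<..<M} - {0}) dist K ({-M<..<M} - {0}) < ereal \<delta>"
  shows "\<bar>lebesgue_sum \<mu> f M K - integral\<^sup>L \<mu> f\<bar> \<le> 2 * \<delta> * measure \<mu> (space \<mu>)"
proof (cases "M > 0")
  case True
  interpret finite_measure \<mu> by fact
  let ?p = "partition_points M K" and ?n = "card (K \<union> {0})"
  \<comment> \<open>The \<open>?n\<close> points of \<open>K \<union> {0}\<close> and the two end
    points bound \<open>Suc ?n\<close> cells, which matches the inclusive upper limit in the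
    definition.\<close>
  have "lebesgue_sum \<mu> f M K =
      (\<Sum>i<Suc ?n. ?p ! i * measure \<mu> (f -` {?p ! i..<?p ! Suc i} \<inter> space \<mu>))"
    unfolding lebesgue_sum_def Let_def by (simp add: atLeast0AtMost lessThan_Suc_atMost del: sum.lessThan_Suc)
  also have "\<bar>\<dots> - integral\<^sup>L \<mu> f\<bar> \<le> 2 * \<delta> * measure \<mu> (space \<mu>)"
  proof (rule lebesgue_sum_error)
    show "f \<in> borel_measurable \<mu>" by fact
    show "f x \<in> {?p ! 0..<?p ! Suc ?n}" if "x \<in> space \<mu>" for x
      using bound[OF that] partition_points_last[of K M] K by (auto simp: partition_points_first)
    show "?p ! i \<le> ?p ! Suc i" "?p ! Suc i - ?p ! i \<le> 2 * \<delta>" if "i < Suc ?n" for i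
      using partition_points_mesh[OF K True dist, of i] that by auto
  qed
  finally show ?thesis .
next
  case False
  \<comment> \<open>For \<open>M \<le> 0\<close> the bound on \<open>f\<close> is unsatisfiable, so
    the space is empty; sum, integral and error bound are all 0.\<close>
  then have "space \<mu> = {}"
    using bound by force
  then show ?thesis
    by (simp add: lebesgue_sum_def Let_def Bochner_Integration.integral_empty)
qed

theorem theorem5p40:
  fixes \<mu> :: "'a measure" and f :: "'a \<Rightarrow> real" and M :: real
  assumes "finite_measure \<mu>"
    and "f \<in> borel_measurable \<mu>"
    and "\<And>x. x \<in> space \<mu> \<Longrightarrow> \<bar>f x\<bar> < M"
  shows "has_ext ({-M<..<M} - {0}) dist (lebesgue_sum \<mu> f M) (integral\<^sup>L \<mu> f)"
  unfolding has_ext_def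
proof (intro conjI allI impI)
  show "pseudometric_on ({-M<..<M} - {0}) dist"
    by (rule pseudometric_on_dist)
  show "totally_bounded_on ({-M<..<M} - {0}) dist"
    by (intro bounded_imp_totally_bounded_on_dist bounded_diff) simp
  fix \<epsilon> :: real
  assume "\<epsilon> > 0"
  \<comment> \<open>The added 1 avoids division by zero for a null space and makes the final
    estimate strict.\<close>
  define \<delta> where "\<delta> = \<epsilon> / (2 * (measure \<mu> (space \<mu>) + 1))"
  have "\<delta> > 0" "2 * \<delta> * measure \<mu> (space \<mu>) < \<epsilon>"
    using \<open>\<epsilon> > 0\<close> measure_nonneg[of \<mu> "space \<mu>"] by (simp_all add: \<delta>_def field_simps add_pos_nonneg)
  then show "\<exists>\<delta>>0. \<forall>K. finite K \<and> K \<subseteq> {-M<..<M} - {0} \<and>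
      hausdorff_dist_on ({-M<..<M} - {0}) dist K ({-M<..<M} - {0}) < ereal \<delta> \<longrightarrow>
      \<bar>lebesgue_sum \<mu> f M K - integral\<^sup>L \<mu> f\<bar> < \<epsilon>"
    using lebesgue_sum_close[OF assms] by (meson order.strict_trans1)
qed

end
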